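(* Let $n > 2$ and $k \geq 2$ be integers. Let $X_{n,k}$ be the set of $k$-element multisets with elements in $\{0,1,\dots,n-1\}$, let $T_{n,k}: X_{n,k} \to X_{n,k}$ be the map that increments each element of a multiset by $1$ modulo $n$, and for $1 \leq i \leq k$ let $g_i: X_{n,k} \to \mathbb{C}$ send a multiset to its $i$th smallest element (counted with multiplicity). Let $V$ be the complex linear span of the functions $g_i \circ T_{n,k}^j$ ($1 \leq i \leq k$, $0 \leq j < n$), and let $U_{n,k}: V \to V$ be the linear operator $f \mapsto f \circ T_{n,k}$. Then for every $\zeta \in \mathbb{C}$ with $\zeta^n = 1$, the multiplicity of $\zeta$ as an eigenvalue of $U_{n,k}$ is $\lfloor k/2 \rfloor + 1$ if $\zeta = 1$, and is $k$ if $\zeta \neq 1$.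
   Context: A $k$-element multiset $x$ is written as a weakly increasing sequence $x_1 \leq x_2 \leq \cdots \leq x_k$, and $g_i(x) = x_i$. The map $T_{n,k}$ sends each element $a < n-1$ to $a+1$ and each element $n-1$ to $0$ (followed by re-sorting); e.g. for $n=k=3$ it sends $112$ to $022$. Since $U_{n,k}^n = I$, the operator $U_{n,k}$ is diagonalizable, and the multiplicity of an eigenvalue $\zeta$ is the dimension over $\mathbb{C}$ of the eigenspace $\{f \in V : U_{n,k} f = \zeta f\}$. *)

theory Defs
  imports Complex_Main "HOL-Library.Multiset" "HOL-Library.Function_Algebras"
begin

definition X :: "nat \<Rightarrow> nat \<Rightarrow> nat multiset set" where
  "X n k = {x. size x = k \<and> set_mset x \<subseteq> {0..<n}}"

definition T :: "nat \<Rightarrow> nat multiset \<Rightarrow> nat multiset" where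
  "T n x = image_mset (\<lambda>a. (a + 1) mod n) x"

text \<open>The index is 1-based: \<open>g i x\<close> is \<open>x\<^sub>i\<close> for \<open>x\<^sub>1 \<le> \<dots> \<le> x\<^sub>k\<close>.\<close>

definition g :: "nat \<Rightarrow> nat multiset \<Rightarrow> complex" where
  "g i x = of_nat (sorted_list_of_multiset x ! (i - 1))"

text \<open>
  A function \<open>X n k \<rightarrow> \<complex>\<close> is represented by its extension by zero to all multisets, so
  that two functions are equal iff they agree on \<open>X n k\<close>. The additive structure on functions is
  the pointwise one of \<^theory>\<open>HOL-Library.Function_Algebras\<close>.
\<close>

definition on_X :: "nat \<Rightarrow> nat \<Rightarrow> (nat multiset \<Rightarrow> complex) \<Rightarrow> nat multiset \<Rightarrow> complex" where
  "on_X n k f = (\<lambda>x. if x \<in> X n k then f x else 0)"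

definition cscale :: "complex \<Rightarrow> ('a \<Rightarrow> complex) \<Rightarrow> 'a \<Rightarrow> complex" where
  "cscale c f = (\<lambda>x. c * f x)"

interpretation cfun: vector_space "cscale :: complex \<Rightarrow> ('a \<Rightarrow> complex) \<Rightarrow> 'a \<Rightarrow> complex"
  by unfold_locales (auto simp: cscale_def fun_eq_iff algebra_simps)

definition V :: "nat \<Rightarrow> nat \<Rightarrow> (nat multiset \<Rightarrow> complex) set" where
  "V n k = cfun.span {on_X n k (g i \<circ> (T n ^^ j)) | i j. 1 \<le> i \<and> i \<le> k \<and> j < n}"

definition U :: "nat \<Rightarrow> nat \<Rightarrow> (nat multiset \<Rightarrow> complex) \<Rightarrow> nat multiset \<Rightarrow> complex" where
  "U n k f = on_X n k (f \<circ> T n)"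

definition eigenspace :: "nat \<Rightarrow> nat \<Rightarrow> complex \<Rightarrow> (nat multiset \<Rightarrow> complex) set" where
  "eigenspace n k \<zeta> = {f \<in> V n k. U n k f = cscale \<zeta> f}"

text \<open>
  Geometric multiplicity; as \<open>U n k\<close> has finite order on \<open>V n k\<close>, it is diagonalizable and this
  coincides with the algebraic one.
\<close>

definition eigen_multiplicity :: "nat \<Rightarrow> nat \<Rightarrow> complex \<Rightarrow> nat" where
  "eigen_multiplicity n k \<zeta> = cfun.dim (eigenspace n k \<zeta>)"

lemma T_in_X:
  assumes "x \<in> X n k" "n > 0"
  shows "T n x \<in> X n k"
  using assms by (auto simp: X_def T_def)

lemma Tpow_in_X:
  assumes "x \<in> X n k" "n > 0"
  shows "(T n ^^ j) x \<in> X n k"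
  using assms by (induction j) (auto intro: T_in_X)

lemma Tpow_eq:
  assumes "n > 0" "x \<in> X n k"
  shows "(T n ^^ j) x = image_mset (\<lambda>a. (a + j) mod n) x"
proof (induction j)
  case 0
  have "image_mset (\<lambda>a. (a + 0) mod n) x = image_mset (\<lambda>a. a) x"
    using assms by (intro image_mset_cong) (auto simp: X_def)
  then show ?case by simp
next
  case (Suc j)
  have "(T n ^^ Suc j) x = image_mset (\<lambda>a. (a + 1) mod n) (image_mset (\<lambda>a. (a + j) mod n) x)"
    using Suc.IH by (simp only: funpow.simps comp_apply T_def[of n "{#(a + j) mod n. a \<in># x#}"])
  also have "\<dots> = image_mset (\<lambda>a. (a + Suc j) mod n) x"
    by (simp add: multiset.map_comp comp_def mod_Suc_eq)
  finally show ?case .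
qed

lemma Tpow_n: "n > 0 \<Longrightarrow> x \<in> X n k \<Longrightarrow> (T n ^^ n) x = x"
  using Tpow_eq[of n x k n] Tpow_eq[of n x k 0] by simp

lemma linear_U: "Vector_Spaces.linear cscale cscale (U n k)"
  by unfold_locales (auto simp: U_def on_X_def cscale_def fun_eq_iff algebra_simps)

lemma U_in_V:
  assumes "n > 0" "f \<in> V n k"
  shows "U n k f \<in> V n k"
proof -
  interpret U: Vector_Spaces.linear cscale cscale "U n k" by (rule linear_U)
  have gen: "U n k (on_X n k (g i \<circ> (T n ^^ j))) \<in> V n k" if ij: "1 \<le> i" "i \<le> k" "j < n" for i j
  proof -
    have "U n k (on_X n k (g i \<circ> (T n ^^ j))) = on_X n k (g i \<circ> (T n ^^ Suc j))"
      using assms(1) by (auto simp: U_def on_X_def fun_eq_iff T_in_X funpow_swap1)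
    also have "\<dots> = on_X n k (g i \<circ> (T n ^^ (if Suc j = n then 0 else Suc j)))"
      using assms(1) Tpow_n[of n _ k] by (auto simp: on_X_def fun_eq_iff simp del: funpow.simps)
    also have "\<dots> \<in> V n k"
      unfolding V_def using ij assms(1)
      by (intro cfun.span_base CollectI exI[of _ i] exI[of _ "if Suc j = n then 0 else Suc j"]) auto
    finally show ?thesis .
  qed
  have "U n k ` V n k \<subseteq> V n k"
    unfolding V_def U.span_image[symmetric]
    using gen by (intro cfun.span_minimal) (auto simp: V_def)
  then show ?thesis using assms(2) by blast
qed

end

theory Submission
  imports Defs
begin

text \<open>
  Averaging with weights \<open>\<zeta>\<^sup>-\<^sup>j\<close> over the \<open>T\<close>-orbit projects \<open>V\<close> onto the eigenspace of
  \<open>\<zeta>\<close>, which is therefore spanned by the images \<open>h\<^sub>1, \<dots>, h\<^sub>k\<close> of \<open>g\<^sub>1, \<dots>, g\<^sub>k\<close>. Evaluating at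
  the multisets \<open>0\<^sup>a 1\<^sup>k\<^sup>-\<^sup>a\<close> and taking differences in \<open>a\<close>, a vanishing combination
  \<open>\<Sum> c\<^sub>i h\<^sub>i\<close> with \<open>\<zeta> \<noteq> 1\<close> gives \<open>c\<^sub>a = - (n - 1) c\<^sub>b\<close> for \<open>a + b = k + 1\<close>, hence
  \<open>c\<^sub>a = (n - 1)\<^sup>2 c\<^sub>a\<close> and \<open>c\<^sub>a = 0\<close> as \<open>n > 2\<close>. For \<open>\<zeta> = 1\<close> the same differences show that
  \<open>1\<close> and the \<open>h\<^sub>i\<close> with \<open>i \<le> k / 2\<close> are independent, and they span the eigenspace because
  \<open>h\<^sub>i + h\<^sub>b = n (n - 1)\<close> for \<open>i + b = k + 1\<close>: the value \<open>g\<^sub>i y\<close> counts the \<open>m\<close> with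
  \<open>1 \<le> m < n\<close> such that fewer than \<open>i\<close> elements of \<open>y\<close> are below \<open>m\<close>, and rotation
  exchanges the arc \<open>{0..<m}\<close> with the complement of \<open>{0..<n-m}\<close>.
\<close>

section \<open>Linear algebra and cyclic sums\<close>

lemma (in vector_space) dim_span_image_eq_card:
  assumes "finite I"
    and zero: "\<And>c i. (\<Sum>i\<in>I. c i *s b i) = 0 \<Longrightarrow> i \<in> I \<Longrightarrow> c i = 0"
  shows "dim (span (b ` I)) = card I"
proof -
  have inj: "inj_on b I"
  proof (rule inj_onI, rule ccontr)
    fix i j assume ij: "i \<in> I" "j \<in> I" "b i = b j" "i \<noteq> j"
    define c :: "'c \<Rightarrow> 'a" where "c l = (if l = i then 1 else 0) - (if l = j then 1 else 0)" for l
    have *: "(\<Sum>l\<in>I. (if l = p then 1 else 0) *s b l) = b p" if "p \<in> I" for p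
    proof -
      have "(\<Sum>l\<in>I. (if l = p then 1 else 0) *s b l) = (\<Sum>l\<in>I. if l = p then b l else 0)"
        by (intro sum.cong) auto
      then show ?thesis
        using that \<open>finite I\<close> by simp
    qed
    have "(\<Sum>l\<in>I. c l *s b l) = b i - b j"
      unfolding c_def scale_left_diff_distrib sum_subtractf using *[of i] *[of j] ij by simp
    then have "(\<Sum>l\<in>I. c l *s b l) = 0"
      using ij by simp
    from zero[OF this ij(1)] show False
      using ij by (simp add: c_def)
  qed
  have "independent (b ` I)"
  proof (rule independent_if_scalars_zero)
    fix f x assume "(\<Sum>x\<in>b ` I. f x *s x) = 0" "x \<in> b ` I"
    then show "f x = 0"
      using zero[of "f \<circ> b"] by (auto simp: sum.reindex[OF inj])
  qed (use \<open>finite I\<close> in simp)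
  then show ?thesis
    using card_image[OF inj] dim_eq_card[of "b ` I" "span (b ` I)"] span_span by simp
qed

text \<open>Multiplying by \<open>w\<close> moves each term one place up; the end terms
  \<open>F 0\<close> and \<open>w ^ n * F n\<close> agree, which closes the cycle.\<close>

lemma weighted_sum_shift:
  fixes w :: "'a :: comm_ring_1"
  assumes "w ^ n = 1" "F n = F 0"
  shows "w * (\<Sum>j<n. w ^ j * F (Suc j)) = (\<Sum>j<n. w ^ j * F j)"
proof -
  have "F 0 + w * (\<Sum>j<n. w ^ j * F (Suc j)) = (\<Sum>j<Suc n. w ^ j * F j)"
    by (simp only: sum.lessThan_Suc_shift sum_distrib_left) (simp add: mult.assoc)
  also have "\<dots> = (\<Sum>j<n. w ^ j * F j) + F 0"
    using assms by simp
  finally show ?thesis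
    by (simp add: add.commute)
qed

lemma periodic_sum_shift:
  fixes F :: "nat \<Rightarrow> 'a :: comm_ring_1"
  assumes "\<And>j. F (j + n) = F j"
  shows "(\<Sum>j<n. F (j + s)) = (\<Sum>j<n. F j)"
proof (induction s)
  case (Suc s)
  have "(\<Sum>j<n. F (Suc j + s)) = (\<Sum>j<n. F (j + s))"
    using weighted_sum_shift[of 1 n "\<lambda>j. F (j + s)"] assms[of s] by (simp add: add.commute)
  then show ?case
    using Suc by simp
qed simp

section \<open>Order statistics through threshold counts\<close>

lemma sorted_nth_ge_iff:
  assumes "sorted l" "i < length l"
  shows "m \<le> l ! i \<longleftrightarrow> length (filter (\<lambda>a. a < m) l) \<le> i"
proof
  assume "m \<le> l ! i"
  then have "{j. j < length l \<and> l ! j < m} \<subseteq> {..<i}"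
    using sorted_nth_mono[OF assms(1), of i] by (force simp: not_less[symmetric])
  from card_mono[OF _ this] show "length (filter (\<lambda>a. a < m) l) \<le> i"
    by (simp add: length_filter_conv_card)
next
  assume *: "length (filter (\<lambda>a. a < m) l) \<le> i"
  show "m \<le> l ! i"
  proof (rule ccontr)
    assume "\<not> m \<le> l ! i"
    then have "{..i} \<subseteq> {j. j < length l \<and> l ! j < m}"
      using sorted_nth_mono[OF assms(1), of _ i] assms(2) by (fastforce intro: le_less_trans)
    from card_mono[OF _ this] show False
      using * by (simp add: length_filter_conv_card)
  qed
qed

text \<open>A value \<open>v < n\<close> is the number of thresholds \<open>m\<close> in
  \<open>{1..v}\<close>, and sortedness turns \<open>m \<le> v\<close> into a bound on how many
  elements lie below \<open>m\<close>.\<close>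

lemma g_eq_sum_below:
  assumes "y \<in> X n k" "1 \<le> i" "i \<le> k"
  shows "g i y = (\<Sum>m\<in>{1..<n}. of_bool (size {#a \<in># y. a < m#} < i))"
proof -
  define l where "l = sorted_list_of_multiset y"
  have y: "mset l = y" and l: "sorted l" "length l = k" "set l \<subseteq> {0..<n}"
    using assms(1) by (auto simp: l_def X_def simp flip: size_mset)
  have "l ! (i - 1) \<in> set l"
    using l assms by (intro nth_mem) auto
  then have lt: "l ! (i - 1) < n"
    using l by auto
  have "size {#a \<in># y. a < m#} < i \<longleftrightarrow> m \<le> l ! (i - 1)" for m
    using sorted_nth_ge_iff[OF l(1), of "i - 1" m] l(2) assms
    by (auto simp flip: y size_mset mset_filter)
  then have "(\<Sum>m\<in>{1..<n}. of_bool (size {#a \<in># y. a < m#} < i) :: complex)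
      = of_nat (card ({1..<n} \<inter> {m. m \<le> l ! (i - 1)}))"
    by (simp add: of_bool_def sum.If_cases)
  also have "{1..<n} \<inter> {m. m \<le> l ! (i - 1)} = {1..l ! (i - 1)}"
    using lt by auto
  finally show ?thesis
    by (simp add: g_def l_def)
qed

text \<open>Rotation by \<open>n - m\<close> sends each \<open>a \<ge> m\<close> to
  \<open>a - m\<close>, while the elements below \<open>m\<close> land at or above
  \<open>n - m\<close>.\<close>

lemma size_below_rotate:
  assumes "y \<in> X n k" "1 \<le> m" "m < n"
  shows "size {#a \<in># (T n ^^ (n - m)) y. a < n - m#} = k - size {#a \<in># y. a < m#}"
proof -
  have iff: "(a + (n - m)) mod n < n - m \<longleftrightarrow> \<not> a < m" if "a < n" for a
  proof (cases "a < m")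
    case False
    then have "a + (n - m) = (a - m) + n"
      using assms by simp
    then have "(a + (n - m)) mod n = a - m"
      using that by (simp only: mod_add_self2) simp
    then show ?thesis
      using False that by simp
  qed (use assms in simp)
  have "{#a \<in># (T n ^^ (n - m)) y. a < n - m#}
      = image_mset (\<lambda>a. (a + (n - m)) mod n) {#a \<in># y. (a + (n - m)) mod n < n - m#}"
    using assms by (subst Tpow_eq[OF _ assms(1)]) (auto simp: filter_mset_image_mset)
  also have "{#a \<in># y. (a + (n - m)) mod n < n - m#} = {#a \<in># y. \<not> a < m#}"
    using assms(1) iff by (intro filter_mset_cong) (auto simp: X_def)
  finally have "size {#a \<in># (T n ^^ (n - m)) y. a < n - m#} = size {#a \<in># y. \<not> a < m#}"
    by simp
  moreover have "size {#a \<in># y. a < m#} + size {#a \<in># y. \<not> a < m#} = k"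
    using assms(1) by (simp add: X_def flip: size_union multiset_partition)
  ultimately show ?thesis
    by simp
qed

text \<open>Both orbit sums are expanded over thresholds. In the second, replacing \<open>m\<close>
  by \<open>n - m\<close> and shifting the orbit by \<open>n - m\<close> negates the indicator of
  the first, so each of the \<open>n * (n - 1)\<close> pairs of a threshold and a rotation
  contributes 1.\<close>

lemma sum_orbit_g_complement:
  assumes x: "x \<in> X n k" and "n > 0" and i: "1 \<le> i" "i \<le> k"
  shows "(\<Sum>j<n. g i ((T n ^^ j) x)) + (\<Sum>j<n. g (k + 1 - i) ((T n ^^ j) x)) = of_nat (n * (n - 1))"
proof -
  define B where "B m y = size {#a \<in># y. a < m#}" for m and y :: "nat multiset"
  have TX: "(T n ^^ j) x \<in> X n k" for j
    using Tpow_in_X[OF x \<open>n > 0\<close>] .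
  have per: "(T n ^^ (j + n)) x = (T n ^^ j) x" for j
    using Tpow_n[OF \<open>n > 0\<close> x] by (simp add: funpow_add)
  have sum_g: "(\<Sum>j<n. g l ((T n ^^ j) x))
      = (\<Sum>m\<in>{1..<n}. \<Sum>j<n. of_bool (B m ((T n ^^ j) x) < l))" if "1 \<le> l" "l \<le> k" for l
    unfolding B_def by (subst sum.swap) (intro sum.cong refl g_eq_sum_below[OF TX that])
  have "(\<Sum>j<n. g (k + 1 - i) ((T n ^^ j) x))
      = (\<Sum>m\<in>{1..<n}. \<Sum>j<n. of_bool (B m ((T n ^^ j) x) < k + 1 - i))"
    using i by (intro sum_g) auto
  also have "\<dots> = (\<Sum>m\<in>{1..<n}. \<Sum>j<n. of_bool (B (n - m) ((T n ^^ j) x) < k + 1 - i))"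
    by (rule sum.reindex_bij_witness[of _ "\<lambda>m. n - m" "\<lambda>m. n - m"]) auto
  also have "\<dots> = (\<Sum>m\<in>{1..<n}. \<Sum>j<n. of_bool (\<not> B m ((T n ^^ j) x) < i))"
  proof (rule sum.cong[OF refl])
    fix m assume m: "m \<in> {1..<n}"
    have "B (n - m) ((T n ^^ (j + (n - m))) x) = k - B m ((T n ^^ j) x)" for j
      using size_below_rotate[OF TX, of m j] m
      unfolding B_def add.commute[of j] funpow_add comp_apply by simp
    moreover have "B m ((T n ^^ j) x) \<le> k" for j
      using TX[of j] size_filter_mset_lesseq[of "\<lambda>a. a < m" "(T n ^^ j) x"]
      by (simp add: B_def X_def)
    \<comment> \<open>Both \<open>i\<close> and the count are at most \<open>k\<close>, so the
      natural-number differences are exact.\<close>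
    then have "k - B m ((T n ^^ j) x) < k + 1 - i \<longleftrightarrow> \<not> B m ((T n ^^ j) x) < i" for j
      using i(2) le_diff_iff'[of "B m ((T n ^^ j) x)" k i] by (auto simp: Suc_diff_le less_Suc_eq_le not_less)
    ultimately show "(\<Sum>j<n. of_bool (B (n - m) ((T n ^^ j) x) < k + 1 - i))
        = (\<Sum>j<n. of_bool (\<not> B m ((T n ^^ j) x) < i) :: complex)"
      using periodic_sum_shift[of "\<lambda>j. of_bool (B (n - m) ((T n ^^ j) x) < k + 1 - i) :: complex" n "n - m"] per
      by simp
  qed
  finally have "(\<Sum>j<n. g i ((T n ^^ j) x)) + (\<Sum>j<n. g (k + 1 - i) ((T n ^^ j) x))
      = (\<Sum>m\<in>{1..<n}. \<Sum>j<n. of_bool (B m ((T n ^^ j) x) < i) + of_bool (\<not> B m ((T n ^^ j) x) < i))"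
    using sum_g[OF i] by (simp add: sum.distrib)
  also have "\<dots> = (\<Sum>m\<in>{1..<n}. \<Sum>j<n. 1)"
    by (intro sum.cong) auto
  finally show ?thesis
    by (simp add: mult.commute)
qed

section \<open>Projection onto an eigenspace\<close>

lemma sum_cscale_apply: "(\<Sum>i\<in>I. cscale (c i) (f i)) x = (\<Sum>i\<in>I. c i * f i x)"
  by (induction I rule: infinite_finite_induct) (auto simp: cscale_def)

text \<open>For \<open>\<zeta> ^ n = 1\<close> this is, on \<open>V n k\<close>, \<open>n\<close>
  times the spectral projection of \<open>U n k\<close> for the eigenvalue
  \<open>\<zeta>\<close>.\<close>

definition orbit_avg :: "nat \<Rightarrow> nat \<Rightarrow> complex \<Rightarrow> (nat multiset \<Rightarrow> complex) \<Rightarrow> nat multiset \<Rightarrow> complex" where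
  "orbit_avg n k \<zeta> f = on_X n k (\<lambda>x. \<Sum>j<n. inverse \<zeta> ^ j * f ((T n ^^ j) x))"

lemma linear_orbit_avg: "Vector_Spaces.linear cscale cscale (orbit_avg n k \<zeta>)"
  by unfold_locales
    (auto simp: orbit_avg_def on_X_def cscale_def fun_eq_iff algebra_simps sum.distrib sum_distrib_left)

lemma orbit_avg_on_X: "n > 0 \<Longrightarrow> orbit_avg n k \<zeta> (on_X n k f) = orbit_avg n k \<zeta> f"
  by (auto simp: orbit_avg_def on_X_def fun_eq_iff Tpow_in_X)

context
  fixes n k :: nat and \<zeta> :: complex
  assumes n: "n > 0" and root: "\<zeta> ^ n = 1"
begin

lemma root_nonzero: "\<zeta> \<noteq> 0"
  using n root by (auto simp: zero_power)

text \<open>Composing with \<open>T n\<close> shifts the summation index by one, and the sum is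
  cyclic because \<open>T n ^^ n\<close> fixes \<open>X n k\<close> pointwise and
  \<open>\<zeta> ^ n = 1\<close>.\<close>

lemma orbit_avg_comp_T: "orbit_avg n k \<zeta> (f \<circ> T n) = cscale \<zeta> (orbit_avg n k \<zeta> f)"
proof
  fix x
  have "inverse \<zeta> * (\<Sum>j<n. inverse \<zeta> ^ j * f ((T n ^^ Suc j) x)) = (\<Sum>j<n. inverse \<zeta> ^ j * f ((T n ^^ j) x))"
    if "x \<in> X n k"
    using weighted_sum_shift[of "inverse \<zeta>" n "\<lambda>j. f ((T n ^^ j) x)"] Tpow_n[OF n that] root
    by (simp add: power_inverse)
  then show "orbit_avg n k \<zeta> (f \<circ> T n) x = cscale \<zeta> (orbit_avg n k \<zeta> f) x"
    using root_nonzero by (auto simp: orbit_avg_def on_X_def cscale_def field_simps)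
qed

lemma orbit_avg_comp_Tpow: "orbit_avg n k \<zeta> (f \<circ> (T n ^^ j)) = cscale (\<zeta> ^ j) (orbit_avg n k \<zeta> f)"
proof (induction j)
  case (Suc j)
  have "orbit_avg n k \<zeta> (f \<circ> (T n ^^ Suc j)) = orbit_avg n k \<zeta> ((f \<circ> (T n ^^ j)) \<circ> T n)"
    by (simp only: funpow_Suc_right comp_assoc)
  also have "\<dots> = cscale (\<zeta> ^ Suc j) (orbit_avg n k \<zeta> f)"
    by (simp only: orbit_avg_comp_T Suc cfun.scale_scale power_Suc)
  finally show ?case .
qed (simp add: cscale_def)

lemma U_orbit_avg: "U n k (orbit_avg n k \<zeta> f) = cscale \<zeta> (orbit_avg n k \<zeta> f)"
proof -
  have "U n k (orbit_avg n k \<zeta> f) = orbit_avg n k \<zeta> (f \<circ> T n)"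
    using n by (auto simp: U_def orbit_avg_def on_X_def fun_eq_iff T_in_X funpow_swap1)
  then show ?thesis
    by (simp add: orbit_avg_comp_T)
qed

lemma orbit_avg_eigenvector:
  assumes "U n k f = cscale \<zeta> f"
  shows "orbit_avg n k \<zeta> f = cscale (of_nat n) f"
proof
  fix x
  show "orbit_avg n k \<zeta> f x = cscale (of_nat n) f x"
  proof (cases "x \<in> X n k")
    case True
    have step: "f (T n y) = \<zeta> * f y" if "y \<in> X n k" for y
      using fun_cong[OF assms, of y] that by (simp add: U_def on_X_def cscale_def)
    have "f ((T n ^^ j) x) = \<zeta> ^ j * f x" for j
      by (induction j) (simp_all add: step Tpow_in_X[OF True n])
    then have "inverse \<zeta> ^ j * f ((T n ^^ j) x) = f x" for j
      using root_nonzero by (simp add: power_inverse)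
    then show ?thesis
      using True by (simp add: orbit_avg_def on_X_def cscale_def)
  next
    \<comment> \<open>Off \<open>X n k\<close> the image under \<open>U n k\<close> is 0, so the
      eigenvector equation forces \<open>f\<close> to vanish there.\<close>
    case False
    then have "\<zeta> * f x = 0"
      using fun_cong[OF assms, of x] by (simp add: U_def on_X_def cscale_def)
    then show ?thesis
      using False root_nonzero by (simp add: orbit_avg_def on_X_def cscale_def)
  qed
qed

text \<open>An eigenvector is \<open>1 / n\<close> times its own average, and averaging sends the
  generator \<open>g i \<circ> (T n ^^ j)\<close> to a multiple of the average of
  \<open>g i\<close>. Conversely, each such average is an eigenvector and a combination of
  generators.\<close>

lemma eigenspace_eq_span:
  "eigenspace n k \<zeta> = cfun.span ((\<lambda>i. orbit_avg n k \<zeta> (g i)) ` {1..k})" (is "_ = cfun.span ?H")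
proof
  interpret A: Vector_Spaces.linear cscale cscale "orbit_avg n k \<zeta>" by (rule linear_orbit_avg)
  interpret U: Vector_Spaces.linear cscale cscale "U n k" by (rule linear_U)
  have "orbit_avg n k \<zeta> ` V n k \<subseteq> cfun.span ?H"
    unfolding V_def A.span_image[symmetric]
    by (intro cfun.span_minimal)
      (auto simp: orbit_avg_on_X[OF n] orbit_avg_comp_Tpow simp del: o_apply
        intro!: cfun.span_scale[OF cfun.span_base])
  then have *: "cscale (of_nat n) f \<in> cfun.span ?H" if "f \<in> eigenspace n k \<zeta>" for f
    using that orbit_avg_eigenvector[of f] by (auto simp: eigenspace_def)
  have "f \<in> cfun.span ?H" if "f \<in> eigenspace n k \<zeta>" for f
    using cfun.span_scale[OF *[OF that], of "inverse (of_nat n)"] n by simp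
  then show "eigenspace n k \<zeta> \<subseteq> cfun.span ?H"
    by blast
  have "orbit_avg n k \<zeta> (g i) \<in> V n k" if "i \<in> {1..k}" for i
  proof -
    have "orbit_avg n k \<zeta> (g i) = (\<Sum>j<n. cscale (inverse \<zeta> ^ j) (on_X n k (g i \<circ> (T n ^^ j))))"
      by (auto simp: fun_eq_iff orbit_avg_def on_X_def sum_cscale_apply)
    also have "\<dots> \<in> V n k"
      unfolding V_def using that
      by (intro cfun.span_sum cfun.span_scale cfun.span_base) auto
    finally show ?thesis .
  qed
  moreover have "cfun.subspace (eigenspace n k \<zeta>)"
    by (rule cfun.subspaceI)
      (auto simp: eigenspace_def V_def U.add U.scale cfun.span_zero cfun.span_add cfun.span_scale
        cfun.scale_right_distrib cfun.scale_left_commute)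
  ultimately show "cfun.span ?H \<subseteq> eigenspace n k \<zeta>"
    by (intro cfun.span_minimal) (auto simp: eigenspace_def U_orbit_avg)
qed

end

section \<open>Values at multisets of zeros and ones\<close>

definition two_level :: "nat \<Rightarrow> nat \<Rightarrow> nat multiset" where
  "two_level k a = replicate_mset a 0 + replicate_mset (k - a) 1"

lemma two_level_in_X: "n > 1 \<Longrightarrow> a \<le> k \<Longrightarrow> two_level k a \<in> X n k"
  by (auto simp: two_level_def X_def)

lemma g_two_blocks:
  assumes "p \<le> q" "1 \<le> i" "i \<le> a + b"
  shows "g i (replicate_mset a p + replicate_mset b q) = of_nat (if i \<le> a then p else q)"
proof -
  have "replicate_mset a p + replicate_mset b q = mset (replicate a p @ replicate b q)"
    by simp
  moreover have "sorted (replicate a p @ replicate b q)"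
    using assms(1) by (auto simp: sorted_append)
  ultimately have "sorted_list_of_multiset (replicate_mset a p + replicate_mset b q)
      = replicate a p @ replicate b q"
    by (simp only: sorted_list_of_multiset_mset sorted_sort_id)
  then show ?thesis
    using assms by (auto simp: g_def nth_append)
qed

text \<open>For \<open>j < m\<close> the rotated multiset has the blocks \<open>j\<close> and
  \<open>j + 1\<close> in the original order. At \<open>j = m\<close> the ones wrap to 0 and the
  zeros become \<open>m\<close>, so the blocks swap.\<close>

lemma orbit_avg_g_two_level:
  assumes "n = Suc m" "m > 0" "a \<le> k" "1 \<le> i" "i \<le> k"
  shows "orbit_avg n k \<zeta> (g i) (two_level k a)
    = (\<Sum>j<m. inverse \<zeta> ^ j * (of_nat j + of_bool (a < i))) + inverse \<zeta> ^ m * (of_nat m * of_bool (k - a < i))"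
proof -
  have X: "two_level k a \<in> X n k"
    using assms by (intro two_level_in_X) auto
  have T: "(T n ^^ j) (two_level k a)
      = replicate_mset a (j mod n) + replicate_mset (k - a) (Suc j mod n)" for j
    using Tpow_eq[OF _ X, of j] assms by (simp add: two_level_def)
  have "g i ((T n ^^ j) (two_level k a)) = of_nat j + of_bool (a < i)" if "j < m" for j
    using that assms g_two_blocks[of j "Suc j" i a "k - a"] unfolding T by auto
  moreover have "g i ((T n ^^ m) (two_level k a)) = of_nat m * of_bool (k - a < i)"
    using assms g_two_blocks[of 0 m i "k - a" a] unfolding T by (simp add: add.commute)
  ultimately show ?thesis
    using X assms(1) by (simp add: orbit_avg_def on_X_def)
qed

text \<open>Passing from \<open>a\<close> to \<open>a - 1\<close> zeros changes the averages only at
  \<open>i = a\<close>, through the rotations \<open>j < m\<close>, and at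
  \<open>i = k + 1 - a\<close>, through the wrapped one. Assuming equal values rather than zero
  values also covers combinations that are constant on these multisets.\<close>

lemma coeff_relation:
  fixes c :: "nat \<Rightarrow> complex"
  assumes m: "n = Suc m" "m > 0" and I: "I \<subseteq> {1..k}" and a: "1 \<le> a" "a \<le> k"
    and eq: "(\<Sum>i\<in>I. c i * orbit_avg n k \<zeta> (g i) (two_level k (a - 1)))
      = (\<Sum>i\<in>I. c i * orbit_avg n k \<zeta> (g i) (two_level k a))"
  shows "(if a \<in> I then c a else 0) * (\<Sum>j<m. inverse \<zeta> ^ j)
    = inverse \<zeta> ^ m * of_nat m * (if k + 1 - a \<in> I then c (k + 1 - a) else 0)"
proof -
  define s where "s = (\<Sum>j<m. inverse \<zeta> ^ j)"
  define t where "t = inverse \<zeta> ^ m * of_nat m"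
  have fin: "finite I"
    using I finite_subset by blast
  have diff: "orbit_avg n k \<zeta> (g i) (two_level k (a - 1)) - orbit_avg n k \<zeta> (g i) (two_level k a)
      = (if i = a then s else 0) - (if i = k + 1 - a then t else 0)" if "i \<in> I" for i
  proof -
    have i: "1 \<le> i" "i \<le> k"
      using that I by auto
    have b: "of_bool (a - 1 < i) = of_bool (a < i) + (if i = a then 1 else 0 :: complex)"
      "of_bool (k - a < i) = of_bool (k - (a - 1) < i) + (if i = k + 1 - a then 1 else 0 :: complex)"
      using a i by auto
    have "a - 1 \<le> k"
      using a by simp
    then show ?thesis
      using orbit_avg_g_two_level[OF m _ i, of a \<zeta>] orbit_avg_g_two_level[OF m _ i, of "a - 1" \<zeta>] a
      unfolding b by (simp add: s_def t_def distrib_left sum.distrib)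
  qed
  have "0 = (\<Sum>i\<in>I. c i * (orbit_avg n k \<zeta> (g i) (two_level k (a - 1)) - orbit_avg n k \<zeta> (g i) (two_level k a)))"
    using eq by (simp add: right_diff_distrib sum_subtractf)
  also have "\<dots> = (\<Sum>i\<in>I. (if i = a then c i * s else 0) - (if i = k + 1 - a then c i * t else 0))"
    using diff by (intro sum.cong) (auto simp: right_diff_distrib)
  also have "\<dots> = (if a \<in> I then c a * s else 0) - (if k + 1 - a \<in> I then c (k + 1 - a) * t else 0)"
    unfolding sum_subtractf using fin by simp
  finally show ?thesis
    unfolding s_def[symmetric] t_def[symmetric] by (simp add: mult.commute split: if_splits)
qed

section \<open>Independence and the two multiplicities\<close>

lemma eigen_multiplicity_nontrivial:
  assumes "n > 2" "\<zeta> ^ n = 1" "\<zeta> \<noteq> 1"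
  shows "eigen_multiplicity n k \<zeta> = k"
proof -
  obtain m where m: "n = Suc m" "m > 0"
    using assms(1) by (cases n) auto
  define w where "w = inverse \<zeta>"
  have w: "w ^ n = 1" "w \<noteq> 1" "w \<noteq> 0"
    using assms root_nonzero[of n \<zeta>] by (auto simp: w_def power_inverse)
  have "(\<Sum>j<n. w ^ j) = 0"
    using w by (simp add: sum_gp_strict)
  \<comment> \<open>The full geometric sum vanishes, so omitting its last term leaves minus that
    term.\<close>
  then have s: "(\<Sum>j<m. w ^ j) = - (w ^ m)"
    by (simp add: m eq_neg_iff_add_eq_0)
  have "c i = 0" if zero: "(\<Sum>i\<in>{1..k}. cscale (c i) (orbit_avg n k \<zeta> (g i))) = 0" and i: "i \<in> {1..k}" for c i
  proof -
    have "(\<Sum>i\<in>{1..k}. c i * orbit_avg n k \<zeta> (g i) x) = 0" for x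
      using fun_cong[OF zero, of x] by (simp add: sum_cscale_apply)
    then have rel: "c a * - (w ^ m) = w ^ m * of_nat m * c (k + 1 - a)" if "a \<in> {1..k}" for a
      using coeff_relation[OF m order.refl, of a k c \<zeta>] that s by (auto simp: w_def)
    have neg: "c a = - of_nat m * c (k + 1 - a)" if "a \<in> {1..k}" for a
    proof -
      have "w ^ m * (c a + of_nat m * c (k + 1 - a)) = w ^ m * of_nat m * c (k + 1 - a) - c a * - (w ^ m)"
        by (simp add: algebra_simps)
      then have "w ^ m * (c a + of_nat m * c (k + 1 - a)) = 0"
        by (simp only: rel[OF that] diff_self)
      then show ?thesis
        using w by (simp add: eq_neg_iff_add_eq_0)
    qed
    \<comment> \<open>The reflection \<open>i \<mapsto> k + 1 - i\<close> is an involution, so using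
      the relation twice returns to \<open>c i\<close> with factor \<open>m * m\<close>, where
      \<open>m \<ge> 2\<close>.\<close>
    have "c i = - of_nat m * c (k + 1 - i)"
      using neg[OF i] .
    also have "c (k + 1 - i) = - of_nat m * c i"
      using neg[of "k + 1 - i"] i by fastforce
    also have "- of_nat m * (- of_nat m * c i) = of_nat (m * m) * c i"
      by simp
    finally have "c i = of_nat (m * m) * c i" .
    moreover have "m * m \<noteq> 1"
      using assms(1) m by simp
    then have "(of_nat (m * m) :: complex) \<noteq> 1"
      by (metis of_nat_eq_1_iff)
    ultimately show "c i = 0"
      by (metis mult_cancel_right1)
  qed
  then show ?thesis
    using cfun.dim_span_image_eq_card[of "{1..k}" "\<lambda>i. orbit_avg n k \<zeta> (g i)"] assms
    by (simp add: eigen_multiplicity_def eigenspace_eq_span)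
qed

lemma eigen_multiplicity_trivial:
  assumes "n > 1" "k > 0"
  shows "eigen_multiplicity n k 1 = k div 2 + 1"
proof -
  obtain m where m: "n = Suc m" "m > 0"
    using assms(1) by (cases n) auto
  define e where "e = on_X n k (\<lambda>_. 1)"
  define h where "h i = orbit_avg n k 1 (g i)" for i
  \<comment> \<open>Index 0 carries the constant function, so the candidate basis is indexed by
    \<open>{0..k div 2}\<close>.\<close>
  define b where "b i = (if i = 0 then e else h i)" for i :: nat
  define N :: complex where "N = of_nat (n * (n - 1))"
  have N: "N \<noteq> 0"
    using assms by (simp add: N_def)
  have compl: "h i + h (k + 1 - i) = cscale N e" if "i \<in> {1..k}" for i
    using sum_orbit_g_complement[of _ n k i] that assms
    by (auto simp: h_def e_def N_def orbit_avg_def on_X_def cscale_def fun_eq_iff)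
  have "cfun.span (h ` {1..k}) = cfun.span (b ` {0..k div 2})" (is "?L = ?R")
  proof (rule cfun.span_eq[THEN iffD2], intro conjI image_subsetI)
    fix i assume i: "i \<in> {1..k}"
    have low: "h l \<in> ?R" if "1 \<le> l" "l \<le> k div 2" for l
      using that by (intro cfun.span_base) (auto simp: b_def intro!: image_eqI[of _ _ l])
    have e: "e \<in> ?R"
      by (intro cfun.span_base) (auto simp: b_def intro!: image_eqI[of _ _ 0])
    \<comment> \<open>Either \<open>i\<close> or its mirror image lies in the lower half, or
      \<open>k\<close> is odd and \<open>i\<close> is the middle index, where \<open>compl\<close>
      makes \<open>h i\<close> constant on \<open>X n k\<close>.\<close>
    consider "i \<le> k div 2" | "k + 1 - i \<le> k div 2" | "k + 1 - i = i"
      by linarith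
    then show "h i \<in> ?R"
    proof cases
      case 2
      then have "cscale N e - h (k + 1 - i) \<in> ?R"
        using i e low by (intro cfun.span_diff cfun.span_scale) auto
      then show ?thesis
        using compl[OF i] by (metis add_diff_cancel_right')
    next
      case 3
      then have "h i = cscale (N / 2) e"
        using compl[OF i] by (auto simp: cscale_def fun_eq_iff field_simps)
      then show ?thesis
        using e by (simp add: cfun.span_scale)
    qed (use i low in auto)
  next
    fix i assume "i \<in> {0..k div 2}"
    have h: "h l \<in> ?L" if "l \<in> {1..k}" for l
      using that by (intro cfun.span_base) auto
    have "e = cscale (inverse N) (h 1 + h k)"
      using compl[of 1] assms N by simp
    also have "\<dots> \<in> ?L"
      using h assms by (intro cfun.span_scale cfun.span_add) auto
    finally show "b i \<in> ?L"
      using h[of i] \<open>i \<in> {0..k div 2}\<close> by (auto simp: b_def)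
  qed
  moreover have "cfun.dim ?R = card {0..k div 2}"
  proof (rule cfun.dim_span_image_eq_card)
    fix c i assume zero: "(\<Sum>i\<in>{0..k div 2}. cscale (c i) (b i)) = 0" and i: "i \<in> {0..k div 2}"
    have split: "{0..k div 2} = insert 0 {1..k div 2}"
      by auto
    have const: "c 0 * e x + (\<Sum>i\<in>{1..k div 2}. c i * h i x) = 0" for x
    proof -
      have "(\<Sum>i\<in>{1..k div 2}. c i * b i x) = (\<Sum>i\<in>{1..k div 2}. c i * h i x)"
        by (intro sum.cong) (auto simp: b_def)
      then show ?thesis
        using fun_cong[OF zero, of x] unfolding sum_cscale_apply split by (simp add: b_def)
    qed
    have e1: "e (two_level k a) = 1" if "a \<le> k" for a
      using two_level_in_X[of n a k] that assms by (simp add: e_def on_X_def)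
    have S: "(\<Sum>i\<in>{1..k div 2}. c i * h i (two_level k a)) = - c 0" if "a \<le> k" for a
      using const[of "two_level k a"] e1[OF that] by (simp add: eq_neg_iff_add_eq_0 add.commute)
    have pos: "c a = 0" if a: "a \<in> {1..k div 2}" for a
    proof -
      have "(\<Sum>i\<in>{1..k div 2}. c i * h i (two_level k (a - 1))) = (\<Sum>i\<in>{1..k div 2}. c i * h i (two_level k a))"
        using a by (subst (1 2) S) auto
      \<comment> \<open>The mirror image of a lower index has no coefficient, so the relation for
        \<open>\<zeta> = 1\<close> reduces to \<open>c a * m = 0\<close>.\<close>
      moreover have "k + 1 - a \<notin> {1..k div 2}"
        using a by auto
      ultimately show ?thesis
        using coeff_relation[OF m, of "{1..k div 2}" k a c 1] a m by (auto simp: h_def)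
    qed
    then have "c 0 = 0"
      using const[of "two_level k 0"] e1[of 0] by simp
    with pos i show "c i = 0"
      by (cases "i = 0") auto
  qed simp
  ultimately show ?thesis
    using eigenspace_eq_span[of n 1 k] assms by (simp add: eigen_multiplicity_def h_def)
qed

theorem proposition4p2:
  fixes n k :: nat and \<zeta> :: complex
  assumes "n > 2" and "k \<ge> 2" and "\<zeta> ^ n = 1"
  shows "eigen_multiplicity n k \<zeta> = (if \<zeta> = 1 then k div 2 + 1 else k)"
  using assms eigen_multiplicity_trivial[of n k] eigen_multiplicity_nontrivial[of n \<zeta> k] by auto

end
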